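(* Let $\Phi=(D,\varphi)$ be a $\mathbb{T}$-gain digraph whose underlying digraph $D$ is strongly connected. Then $\rho(\Phi)\le\rho(D)$, with equality if and only if $\Phi$ is $\mu$-balanced for some $\mu\in\mathbb{T}$.
   Context: A digraph $D=(V,\mathcal{A})$ has a finite vertex set $V=\{v_1,\dots,v_n\}$ and a set $\mathcal{A}$ of ordered pairs of distinct vertices, called arcs (no loops; at most one arc from $v_i$ to $v_j$ for each ordered pair; opposite arcs may both be present). A directed cycle is a closed directed walk whose vertices are distinct except that the first and last coincide (so its length is at least $2$; length $2$ is allowed). $D$ is strongly connected if every ordered pair of vertices is joined by a directed path. Let $\mathbb{T}=\{z\in\mathbb{C}:|z|=1\}$. A $\mathbb{T}$-gain digraph is a pair $\Phi=(D,\varphi)$ with $\varphi:\mathcal{A}\to\mathbb{T}$ an arbitrary function (no relation between gains of opposite arcs). Its gain adjacency matrix $A(\Phi)$ has entries $A(\Phi)_{ij}=\varphi(v_i,v_j)$ if $(v_i,v_j)\in\mathcal{A}$ and $0$ otherwise; $A(D)$ is the $0/1$ adjacency matrix of $D$ ($A(D)_{ij}=1$ iff $(v_i,v_j)\in\mathcal{A}$). $\rho(\Phi)$ and $\rho(D)$ denote the spectral radii (maximum modulus of a complex eigenvalue) of $A(\Phi)$ and $A(D)$. The gain $\varphi(C)$ of a directed cycle is the product of the gains of its arcs. For $\mu\in\mathbb{T}$, $\Phi$ is $\mu$-balanced if $\varphi(C)=\mu^{|C|}$ for every directed cycle $C$ of $D$, where $|C|$ is the length of $C$. *)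

theory Defs
  imports
    "Graph_Theory.Digraph_Component"
    "Graph_Theory.Pair_Digraph"
    "Jordan_Normal_Form.Spectral_Radius"
begin

text \<open>
  Digraphs with at most one arc per ordered pair are taken from the \<open>Graph_Theory\<close> entry:
  \<open>pair_digraph\<close> means finite, loop-free, with arcs being pairs of vertices. The gain function
  is total on pairs, but only its values on arcs are ever constrained or used.
\<close>

locale T_gain_digraph = pair_digraph D for D :: "'a pair_pre_digraph" +
  fixes \<phi> :: "'a \<times> 'a \<Rightarrow> complex"
  assumes gain_unit: "e \<in> parcs D \<Longrightarrow> cmod (\<phi> e) = 1"

text \<open>
  Matrix rows and columns are indexed by \<open>0..<length vs\<close>, where the list \<open>vs\<close> is an enumeration
  \<open>v\<^sub>1, ..., v\<^sub>n\<close> of the vertices. The 0/1 matrix has complex entries because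
  \<open>spectral_radius\<close> is defined for complex matrices.
\<close>

definition adjacency_mat :: "'a pair_pre_digraph \<Rightarrow> 'a list \<Rightarrow> complex mat" where
  "adjacency_mat D vs = mat (length vs) (length vs)
     (\<lambda>(i, j). if (vs ! i, vs ! j) \<in> parcs D then 1 else 0)"

definition gain_adjacency_mat ::
  "'a pair_pre_digraph \<Rightarrow> ('a \<times> 'a \<Rightarrow> complex) \<Rightarrow> 'a list \<Rightarrow> complex mat" where
  "gain_adjacency_mat D \<phi> vs = mat (length vs) (length vs)
     (\<lambda>(i, j). if (vs ! i, vs ! j) \<in> parcs D then \<phi> (vs ! i, vs ! j) else 0)"

definition walk_gain :: "('a \<times> 'a \<Rightarrow> complex) \<Rightarrow> ('a \<times> 'a) awalk \<Rightarrow> complex" where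
  "walk_gain \<phi> p = prod_list (map \<phi> p)"

text \<open>
  A cycle is given by its list of arcs, so \<open>length p\<close> is the length of the cycle. In a loop-free
  digraph \<open>pre_digraph.cycle\<close> includes exactly the directed cycles of length at least 2.
\<close>

definition mu_balanced :: "'a pair_pre_digraph \<Rightarrow> ('a \<times> 'a \<Rightarrow> complex) \<Rightarrow> complex \<Rightarrow> bool" where
  "mu_balanced D \<phi> \<mu> \<longleftrightarrow>
     (\<forall>p. pre_digraph.cycle (with_proj D) p \<longrightarrow> walk_gain \<phi> p = \<mu> ^ length p)"

end

(* Write A and B for the plain and the gain adjacency matrix. If B f = l f, then x = |f| satisfies
   A x >= |l| x, and such a subinvariant vector forces |l| <= rho(A), since otherwise the powers of A
   would grow too fast. If |l| = rho(A), then A x = rho(A) x with x > 0: a strict inequality anywhere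
   would be spread by powers of I + A to all vertices, giving a subinvariant vector for a number
   above rho(A). Hence the triangle inequality |B f| <= A |f| is tight at every vertex, which aligns
   the phases d = f / |f| as phi(v,w) d(w) = mu d(v); along a cycle the d cancel, so Phi is
   mu-balanced. Conversely, mu-balance extends from cycles to closed walks, so gains of walks from a
   root, normalised by mu^length, give the reciprocals of such a d, and B = mu diag(d) A diag(d)^-1. *)
theory Submission
  imports Defs
begin

section \<open>Spectral radius and subinvariant vectors of nonnegative matrices\<close>

text \<open>A nonnegative matrix preserves entrywise inequalities, so \<open>N *\<^sub>v x\<close>
  is again subinvariant for \<open>q\<close>. The induction therefore generalises over
  \<open>x\<close>.\<close>

lemma pow_mat_mult_vec_ge:
  fixes N :: "real mat"
  assumes N: "N \<in> carrier_mat n n" and nonneg: "\<And>i j. i < n \<Longrightarrow> j < n \<Longrightarrow> 0 \<le> N $$ (i, j)"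
    and q: "0 \<le> q" and x: "x \<in> carrier_vec n" and ge: "\<And>i. i < n \<Longrightarrow> q * x $ i \<le> (N *\<^sub>v x) $ i"
    and i: "i < n"
  shows "q ^ k * x $ i \<le> (N ^\<^sub>m k *\<^sub>v x) $ i"
  using x ge i
proof (induction k arbitrary: x i)
  case 0
  then show ?case using N by simp
next
  case (Suc k)
  define y where "y = N *\<^sub>v x"
  have y: "y \<in> carrier_vec n" unfolding y_def using N Suc.prems(1) by (rule mult_mat_vec_carrier)
  have xy: "q * x $ j \<le> y $ j" if "j < n" for j using Suc.prems(2)[OF that] unfolding y_def .
  have "q * y $ j \<le> (N *\<^sub>v y) $ j" if j: "j < n" for j
  proof -
    have "q * y $ j = (\<Sum>l<n. N $$ (j, l) * (q * x $ l))"
      using j N Suc.prems(1) unfolding y_def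
      by (simp add: scalar_prod_def sum_distrib_left atLeast0LessThan mult_ac)
    also have "\<dots> \<le> (\<Sum>l<n. N $$ (j, l) * y $ l)"
      using xy nonneg[OF j] by (intro sum_mono mult_left_mono) auto
    also have "\<dots> = (N *\<^sub>v y) $ j"
      using j N y by (simp add: scalar_prod_def atLeast0LessThan)
    finally show ?thesis .
  qed
  then have IH: "q ^ k * y $ i \<le> (N ^\<^sub>m k *\<^sub>v y) $ i"
    by (intro Suc.IH y) (auto simp: Suc.prems)
  have "q ^ Suc k * x $ i = q ^ k * (q * x $ i)" by simp
  also have "\<dots> \<le> q ^ k * y $ i"
    using xy[OF Suc.prems(3)] q by (intro mult_left_mono) auto
  also note IH
  also have "N ^\<^sub>m k *\<^sub>v y = N ^\<^sub>m Suc k *\<^sub>v x"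
    unfolding y_def using assoc_mult_mat_vec[OF pow_carrier_mat[OF N] N Suc.prems(1)] by simp
  finally show ?case .
qed

lemma spectral_radius_nonneg:
  assumes "A \<in> carrier_mat n n" "0 < n"
  shows "0 \<le> spectral_radius A"
  using spectral_radius_mem_max(1)[OF assms] by auto

lemma norm_eigenvalue_le_spectral_radius:
  assumes A: "A \<in> carrier_mat n n" and ev: "eigenvalue A l"
  shows "cmod l \<le> spectral_radius A"
proof -
  have "0 < n" using eigenvalue_imp_nonzero_dim[OF A ev] .
  then show ?thesis
    using spectral_radius_mem_max(2)[OF A, of "cmod l"] ev unfolding spectrum_def by auto
qed

lemma ex_eigenvalue_spectral_radius:
  assumes "A \<in> carrier_mat n n" "0 < n"
  obtains l where "eigenvalue A l" "cmod l = spectral_radius A"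
  using spectral_radius_mem_max(1)[OF assms] unfolding spectrum_def by auto

text \<open>Carries eigenvalues of a rescaled matrix back to \<open>A\<close>, so that the spectral
  radius of \<open>A\<close> controls that of the rescaled matrix.\<close>

lemma eigenvalue_smult_mat:
  fixes A :: "'a :: field mat"
  assumes A: "A \<in> carrier_mat n n" and c: "c \<noteq> 0" and ev: "eigenvalue (inverse c \<cdot>\<^sub>m A) l"
  shows "eigenvalue A (c * l)"
proof -
  obtain v where v: "v \<in> carrier_vec n" "v \<noteq> 0\<^sub>v n" and eq: "(inverse c \<cdot>\<^sub>m A) *\<^sub>v v = l \<cdot>\<^sub>v v"
    using ev A unfolding eigenvalue_def eigenvector_def by auto
  have "A *\<^sub>v v = (c * l) \<cdot>\<^sub>v v"
  proof (rule eq_vecI)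
    fix i assume i: "i < dim_vec ((c * l) \<cdot>\<^sub>v v)"
    then have "((inverse c \<cdot>\<^sub>m A) *\<^sub>v v) $ i = inverse c * (A *\<^sub>v v) $ i"
      using v A by (simp add: scalar_prod_def sum_distrib_left mult.assoc)
    moreover have "(l \<cdot>\<^sub>v v) $ i = l * v $ i" using i by simp
    ultimately have "inverse c * (A *\<^sub>v v) $ i = l * v $ i" unfolding eq by simp
    then show "(A *\<^sub>v v) $ i = ((c * l) \<cdot>\<^sub>v v) $ i" using c i by (simp add: field_simps)
  qed (use A v in auto)
  then show ?thesis using v A unfolding eigenvalue_def eigenvector_def by auto
qed

text \<open>The powers of \<open>M / s\<close> are bounded once \<open>s\<close> exceeds the spectral radius, which rules out a
  subinvariant vector for a factor \<open>t > s\<close>.\<close>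

lemma spectral_radius_ge_if_subinvariant:
  fixes M :: "real mat"
  assumes M: "M \<in> carrier_mat n n" and nonneg: "\<And>i j. i < n \<Longrightarrow> j < n \<Longrightarrow> 0 \<le> M $$ (i, j)"
    and x: "x \<in> carrier_vec n" and x0: "\<And>i. i < n \<Longrightarrow> 0 \<le> x $ i" and i: "i < n" "0 < x $ i"
    and ge: "\<And>i. i < n \<Longrightarrow> t * x $ i \<le> (M *\<^sub>v x) $ i"
  shows "t \<le> spectral_radius (map_mat complex_of_real M)" (is "_ \<le> spectral_radius ?A")
proof (rule ccontr)
  assume "\<not> t \<le> spectral_radius ?A"
  then obtain s where s: "spectral_radius ?A < s" "s < t"
    using dense[of "spectral_radius ?A" t] by (auto simp: not_le)
  have A: "?A \<in> carrier_mat n n" using M by simp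
  have n: "0 < n" using i by simp
  have s0: "0 < s" using spectral_radius_nonneg[OF A n] s by simp
  \<comment> \<open>\<open>N\<close> and \<open>B\<close> are one matrix over two fields: order
    arguments take place over the reals, spectral bounds over the complex numbers.\<close>
  define N where "N = inverse s \<cdot>\<^sub>m M"
  define B where "B = inverse (complex_of_real s) \<cdot>\<^sub>m ?A"
  have N: "N \<in> carrier_mat n n" using M unfolding N_def by simp
  have B: "B \<in> carrier_mat n n" using M unfolding B_def by simp
  have BN: "B = map_mat complex_of_real N"
    unfolding B_def N_def using M by (intro eq_matI) auto
  obtain l where l: "eigenvalue B l" "cmod l = spectral_radius B"
    using ex_eigenvalue_spectral_radius[OF B n] .
  have "cmod (complex_of_real s * l) \<le> spectral_radius ?A"
    using eigenvalue_smult_mat[OF A, of "complex_of_real s" l] l(1) s0 unfolding B_def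
    by (intro norm_eigenvalue_le_spectral_radius[OF A]) auto
  then have "s * spectral_radius B \<le> spectral_radius ?A" using s0 l(2) by (simp add: norm_mult)
  then have "s * spectral_radius B < s * 1" using s by simp
  then have "spectral_radius B < 1" using s0 by simp
  then obtain c where "\<And>k. norm_bound (B ^\<^sub>m k) c"
    using spectral_radius_jnf_norm_bound_less_1_upper_triangular[OF B] by blast
  then have bd: "\<bar>(N ^\<^sub>m k) $$ (a, b)\<bar> \<le> c" if "a < n" "b < n" for a b k
    using that N pow_carrier_mat[OF N, of k]
    unfolding BN of_real_hom.mat_hom_pow[OF N, symmetric] norm_bound_def by auto
  have geN: "(t / s) * x $ j \<le> (N *\<^sub>v x) $ j" if "j < n" for j
  proof -
    have "(N *\<^sub>v x) $ j = inverse s * (M *\<^sub>v x) $ j"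
      unfolding N_def using that M x by (simp add: scalar_prod_def sum_distrib_left mult.assoc)
    moreover have "inverse s * (t * x $ j) \<le> inverse s * (M *\<^sub>v x) $ j"
      using ge[OF that] s0 by (intro mult_left_mono) auto
    ultimately show ?thesis by (simp add: field_simps)
  qed
  \<comment> \<open>The right-hand side does not depend on \<open>k\<close>, while
    \<open>t / s\<close> exceeds 1; positivity of \<open>x $ i\<close> permits the division.\<close>
  have bounded: "(t / s) ^ k \<le> (\<Sum>j<n. c * x $ j) / x $ i" for k
  proof -
    have "(t / s) ^ k * x $ i \<le> (N ^\<^sub>m k *\<^sub>v x) $ i"
      using s s0 by (intro pow_mat_mult_vec_ge[OF N _ _ x geN i(1)])
        (use nonneg M in \<open>auto simp: N_def\<close>)
    also have "\<dots> = (\<Sum>j<n. (N ^\<^sub>m k) $$ (i, j) * x $ j)"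
      using i(1) carrier_vecD[OF x] carrier_matD[OF N]
      by (simp add: scalar_prod_def atLeast0LessThan)
    also have "\<dots> \<le> (\<Sum>j<n. c * x $ j)"
      using bd[OF i(1)] x0 by (intro sum_mono mult_right_mono) (auto dest: abs_le_D1)
    finally show ?thesis using i(2) by (simp add: field_simps)
  qed
  have "1 < t / s" using s s0 by simp
  then obtain k where "(\<Sum>j<n. c * x $ j) / x $ i < (t / s) ^ k"
    using real_arch_pow by blast
  with bounded[of k] show False by simp
qed

section \<open>Adjacency matrices as operators on functions on the vertices\<close>

text \<open>Translates row sums over list indices into sums over out-neighbours, so that later
  arguments can avoid indices.\<close>

lemma sum_nth_arcs:
  assumes "distinct vs" "E \<subseteq> set vs \<times> set vs"
  shows "(\<Sum>j<length vs. if (v, vs ! j) \<in> E then f (vs ! j) else 0) = (\<Sum>w\<in>E `` {v}. f w)"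
proof -
  have "(\<Sum>w\<in>E `` {v}. f w) = (\<Sum>w\<in>{w \<in> set vs. (v, w) \<in> E}. f w)"
    using assms(2) by (intro sum.cong) auto
  also have "\<dots> = (\<Sum>w\<in>set vs. if (v, w) \<in> E then f w else 0)"
    by (rule sum.inter_filter) simp
  also have "\<dots> = (\<Sum>j<length vs. if (v, vs ! j) \<in> E then f (vs ! j) else 0)"
    by (rule sum.reindex_bij_betw[OF bij_betw_nth[OF assms(1) refl refl], symmetric])
  finally show ?thesis by simp
qed

lemma gain_adjacency_mat_carrier: "gain_adjacency_mat D \<phi> vs \<in> carrier_mat (length vs) (length vs)"
  unfolding gain_adjacency_mat_def by simp

lemma dim_gain_adjacency_mat [simp]:
  "dim_row (gain_adjacency_mat D \<phi> vs) = length vs" "dim_col (gain_adjacency_mat D \<phi> vs) = length vs"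
  unfolding gain_adjacency_mat_def by simp_all

text \<open>Treating the plain matrix as the case of trivial gains lets the eigenvalue lemmas below
  serve both matrices.\<close>

lemma adjacency_mat_eq_gain_adjacency_mat: "adjacency_mat D vs = gain_adjacency_mat D (\<lambda>_. 1) vs"
  unfolding adjacency_mat_def gain_adjacency_mat_def by simp

lemma gain_adjacency_mat_mult_vec:
  assumes "distinct vs" "parcs D \<subseteq> set vs \<times> set vs" "i < length vs"
    and "\<And>j. j < length vs \<Longrightarrow> x $ j = f (vs ! j)" "dim_vec x = length vs"
  shows "(gain_adjacency_mat D \<phi> vs *\<^sub>v x) $ i = (\<Sum>w\<in>parcs D `` {vs ! i}. \<phi> (vs ! i, w) * f w)"
proof -
  have "(gain_adjacency_mat D \<phi> vs *\<^sub>v x) $ i =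
      (\<Sum>j<length vs. if (vs ! i, vs ! j) \<in> parcs D then \<phi> (vs ! i, vs ! j) * f (vs ! j) else 0)"
    using assms(3-5) unfolding gain_adjacency_mat_def
    by (auto simp: scalar_prod_def atLeast0LessThan intro!: sum.cong)
  also have "\<dots> = (\<Sum>w\<in>parcs D `` {vs ! i}. \<phi> (vs ! i, w) * f w)"
    by (rule sum_nth_arcs[OF assms(1,2)])
  finally show ?thesis .
qed

lemma eigenvalue_gain_adjacency_matI:
  assumes vs: "distinct vs" "parcs D \<subseteq> set vs \<times> set vs"
    and u: "u \<in> set vs" "f u \<noteq> 0"
    and eq: "\<And>v. v \<in> set vs \<Longrightarrow> (\<Sum>w\<in>parcs D `` {v}. \<phi> (v, w) * f w) = l * f v"
  shows "eigenvalue (gain_adjacency_mat D \<phi> vs) l"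
proof -
  define x where "x = vec (length vs) (\<lambda>i. f (vs ! i))"
  let ?A = "gain_adjacency_mat D \<phi> vs"
  obtain i where "i < length vs" "vs ! i = u" using u by (auto simp: in_set_conv_nth)
  then have "x $ i \<noteq> 0" "0\<^sub>v (length vs) $ i = (0::complex)" using u by (auto simp: x_def)
  then have "x \<noteq> 0\<^sub>v (length vs)" by auto
  moreover have "?A *\<^sub>v x = l \<cdot>\<^sub>v x"
  proof (rule eq_vecI)
    fix i assume i: "i < dim_vec (l \<cdot>\<^sub>v x)"
    then have "i < length vs" by (simp add: x_def)
    then show "(?A *\<^sub>v x) $ i = (l \<cdot>\<^sub>v x) $ i"
      using eq[of "vs ! i"] by (subst gain_adjacency_mat_mult_vec[OF vs, where f = f]) (auto simp: x_def)
  qed (simp add: x_def)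
  ultimately show ?thesis
    unfolding eigenvalue_def eigenvector_def by (intro exI[of _ x]) (simp add: x_def)
qed

text \<open>The eigenvector is extended by 0 outside \<open>vs\<close>. No arcs leave from there, so
  the eigenvalue equation holds at every \<open>v\<close> without a side condition.\<close>

lemma eigenvalue_gain_adjacency_matE:
  assumes vs: "distinct vs" "parcs D \<subseteq> set vs \<times> set vs"
    and ev: "eigenvalue (gain_adjacency_mat D \<phi> vs) l"
  obtains f u where "u \<in> set vs" "f u \<noteq> 0" "\<And>v. v \<notin> set vs \<Longrightarrow> f v = 0"
    "\<And>v. (\<Sum>w\<in>parcs D `` {v}. \<phi> (v, w) * f w) = l * f v"
proof -
  let ?A = "gain_adjacency_mat D \<phi> vs" and ?n = "length vs"
  obtain x where x: "x \<in> carrier_vec ?n" "x \<noteq> 0\<^sub>v ?n" and eq: "?A *\<^sub>v x = l \<cdot>\<^sub>v x"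
    using ev unfolding eigenvalue_def eigenvector_def by auto
  define f where "f v = (if v \<in> set vs then x $ the_inv_into {..<?n} ((!) vs) v else 0)" for v
  have inj: "inj_on ((!) vs) {..<?n}" using vs(1) by (simp add: inj_on_nth)
  have f: "x $ j = f (vs ! j)" if "j < ?n" for j
    using that by (simp add: f_def the_inv_into_f_f[OF inj])
  obtain i where i: "i < ?n" "x $ i \<noteq> 0" using x by (metis carrier_vecD eq_vecI index_zero_vec)
  show thesis
  proof (rule that[of "vs ! i" f])
    show "vs ! i \<in> set vs" "f (vs ! i) \<noteq> 0" using i f by auto
    show "f v = 0" if "v \<notin> set vs" for v using that by (simp add: f_def)
    show "(\<Sum>w\<in>parcs D `` {v}. \<phi> (v, w) * f w) = l * f v" for v
    proof (cases "v \<in> set vs")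
      case True
      then obtain j where j: "j < ?n" "v = vs ! j" by (auto simp: in_set_conv_nth)
      have "(\<Sum>w\<in>parcs D `` {v}. \<phi> (v, w) * f w) = (?A *\<^sub>v x) $ j"
        using gain_adjacency_mat_mult_vec[OF vs j(1), of x f \<phi>] f x(1) j(2) by simp
      also have "\<dots> = l * f v" using eq j f x(1) by simp
      finally show ?thesis .
    next
      case False
      then have "parcs D `` {v} = {}" using vs(2) by auto
      then show ?thesis using False by (simp add: f_def)
    qed
  qed
qed

lemma spectral_radius_adjacency_mat_ge:
  fixes x :: "'a \<Rightarrow> real"
  assumes vs: "distinct vs" "parcs D \<subseteq> set vs \<times> set vs"
    and x: "\<And>v. v \<in> set vs \<Longrightarrow> 0 \<le> x v" "u \<in> set vs" "0 < x u"
    and ge: "\<And>v. v \<in> set vs \<Longrightarrow> t * x v \<le> (\<Sum>w\<in>parcs D `` {v}. x w)"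
  shows "t \<le> spectral_radius (adjacency_mat D vs)"
proof -
  let ?n = "length vs"
  define M :: "real mat" where "M = mat ?n ?n (\<lambda>(i, j). if (vs ! i, vs ! j) \<in> parcs D then 1 else 0)"
  define y where "y = vec ?n (\<lambda>i. x (vs ! i))"
  have A: "adjacency_mat D vs = map_mat complex_of_real M"
    unfolding adjacency_mat_def M_def by (intro eq_matI) auto
  obtain i where i: "i < ?n" "vs ! i = u" using x by (auto simp: in_set_conv_nth)
  \<comment> \<open>Computed directly for the real matrix \<open>M\<close>, since
    \<open>gain_adjacency_mat_mult_vec\<close> concerns complex matrices.\<close>
  have My: "(M *\<^sub>v y) $ j = (\<Sum>w\<in>parcs D `` {vs ! j}. x w)" if "j < ?n" for j
  proof -
    have "(M *\<^sub>v y) $ j = (\<Sum>k<?n. if (vs ! j, vs ! k) \<in> parcs D then x (vs ! k) else 0)"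
      using that unfolding M_def y_def
      by (auto simp: scalar_prod_def atLeast0LessThan intro!: sum.cong)
    also have "\<dots> = (\<Sum>w\<in>parcs D `` {vs ! j}. x w)" by (rule sum_nth_arcs[OF vs])
    finally show ?thesis .
  qed
  show ?thesis unfolding A
  proof (rule spectral_radius_ge_if_subinvariant[of M ?n y i t])
    show "t * y $ j \<le> (M *\<^sub>v y) $ j" if "j < ?n" for j
      using ge[of "vs ! j"] that My by (simp add: y_def)
  qed (use i x in \<open>auto simp: M_def y_def\<close>)
qed

section \<open>Lazy steps and the rigidity of subinvariant functions\<close>

text \<open>Powers of \<open>I + A\<close>, unlike those of \<open>A\<close>, eventually make every nonzero nonnegative function positive
  also when the digraph is periodic.\<close>

definition lazy_step :: "'a rel \<Rightarrow> ('a \<Rightarrow> real) \<Rightarrow> 'a \<Rightarrow> real" where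
  "lazy_step E f v = f v + (\<Sum>w\<in>E `` {v}. f w)"

text \<open>This is \<open>A - t I\<close> applied to \<open>f\<close>: nonnegative values express
  subinvariance for \<open>t\<close>, and zeros express the eigenvalue equation.\<close>

definition defect :: "'a rel \<Rightarrow> real \<Rightarrow> ('a \<Rightarrow> real) \<Rightarrow> 'a \<Rightarrow> real" where
  "defect E t f v = (\<Sum>w\<in>E `` {v}. f w) - t * f v"

text \<open>Both operators are polynomials in the adjacency operator, namely \<open>A - t I\<close>
  and \<open>I + A\<close>, hence they commute.\<close>

lemma defect_lazy_step: "defect E t (lazy_step E f) = lazy_step E (defect E t f)"
  unfolding defect_def lazy_step_def
  by (auto simp: fun_eq_iff sum.distrib sum_subtractf sum_distrib_left algebra_simps)

lemma defect_funpow_lazy_step: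
  "defect E t ((lazy_step E ^^ k) f) = (lazy_step E ^^ k) (defect E t f)"
  by (induction k) (simp_all add: defect_lazy_step)

lemma lazy_step_ge:
  assumes "\<And>v. 0 \<le> f v"
  shows "f v \<le> lazy_step E f v"
  using assms by (simp add: lazy_step_def sum_nonneg)

lemma funpow_lazy_step_nonneg:
  assumes "\<And>v. 0 \<le> f v"
  shows "0 \<le> (lazy_step E ^^ k) f v"
proof (induction k arbitrary: v)
  case (Suc k)
  have "(lazy_step E ^^ k) f v \<le> lazy_step E ((lazy_step E ^^ k) f) v"
    by (intro lazy_step_ge Suc)
  with Suc[of v] show ?case by simp
qed (use assms in simp)

lemma funpow_lazy_step_mono:
  assumes "\<And>v. 0 \<le> f v" "k \<le> m"
  shows "(lazy_step E ^^ k) f v \<le> (lazy_step E ^^ m) f v"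
  using assms(2)
proof (induction m rule: dec_induct)
  case (step m)
  have "(lazy_step E ^^ m) f v \<le> lazy_step E ((lazy_step E ^^ m) f) v"
    by (intro lazy_step_ge funpow_lazy_step_nonneg assms(1))
  with step show ?case by simp
qed simp

text \<open>Each lazy step moves positivity one arc backwards, so a path from \<open>v\<close> to
  \<open>u\<close> eventually makes the value at \<open>v\<close> positive.\<close>

lemma ex_funpow_lazy_step_pos:
  assumes E: "finite E" and f: "\<And>v. 0 \<le> f v" "0 < f u"
    and V: "finite V" "\<And>v. v \<in> V \<Longrightarrow> (v, u) \<in> E\<^sup>*"
  shows "\<exists>k. \<forall>v\<in>V. 0 < (lazy_step E ^^ k) f v"
proof -
  have "\<exists>k. 0 < (lazy_step E ^^ k) f v" if "(v, u) \<in> E\<^sup>*" for v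
    using that
  proof (induction rule: converse_rtrancl_induct)
    case base
    show ?case using f(2) by (intro exI[of _ 0]) simp
  next
    case (step v w)
    then obtain k where k: "0 < (lazy_step E ^^ k) f w" by blast
    let ?g = "(lazy_step E ^^ k) f"
    have g: "0 \<le> ?g z" for z using funpow_lazy_step_nonneg[of f, OF f(1)] .
    have "finite (E `` {v})" using E by (simp add: finite_Image)
    then have "?g w \<le> (\<Sum>z\<in>E `` {v}. ?g z)"
      using step(1) g by (intro member_le_sum) auto
    then have "0 < lazy_step E ?g v" using k g[of v] by (simp add: lazy_step_def)
    then show ?case by (intro exI[of _ "Suc k"]) simp
  qed
  then obtain k where k: "\<And>v. v \<in> V \<Longrightarrow> 0 < (lazy_step E ^^ k v) f v" using V(2) by metis
  \<comment> \<open>Values never decrease under lazy steps, so a common bound of the finitely many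
    exponents works for all of \<open>V\<close>.\<close>
  obtain m where "\<And>v. v \<in> V \<Longrightarrow> k v \<le> m"
    using V(1) by (metis finite_imageI finite_nat_set_iff_bounded_le imageI)
  then have "\<forall>v\<in>V. 0 < (lazy_step E ^^ m) f v"
    using k funpow_lazy_step_mono[of f, OF f(1)] by (meson less_le_trans)
  then show ?thesis by blast
qed

text \<open>The rigid case of \<open>spectral_radius_adjacency_mat_ge\<close>: with factor
  \<open>\<rho>\<close> there is no slack at any vertex, and strong connectivity spreads positivity
  from \<open>u\<close>.\<close>

lemma subinvariant_at_spectral_radius:
  fixes x :: "'a \<Rightarrow> real"
  assumes vs: "distinct vs" "parcs D \<subseteq> set vs \<times> set vs"
    and conn: "\<And>u v. u \<in> set vs \<Longrightarrow> v \<in> set vs \<Longrightarrow> (u, v) \<in> (parcs D)\<^sup>*"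
    and x: "\<And>v. 0 \<le> x v" "\<And>v. v \<notin> set vs \<Longrightarrow> x v = 0" "u \<in> set vs" "0 < x u"
    and rho: "\<rho> = spectral_radius (adjacency_mat D vs)"
    and ge: "\<And>v. v \<in> set vs \<Longrightarrow> \<rho> * x v \<le> (\<Sum>w\<in>parcs D `` {v}. x w)"
  shows "v \<in> set vs \<Longrightarrow> (\<Sum>w\<in>parcs D `` {v}. x w) = \<rho> * x v"
    and "v \<in> set vs \<Longrightarrow> 0 < x v"
proof -
  let ?E = "parcs D"
  have E: "finite ?E" using vs(2) finite_subset by blast
  have arcs_out: "?E `` {z} = {}" if "z \<notin> set vs" for z using that vs(2) by auto
  have d0: "0 \<le> defect ?E \<rho> x z" for z
    using ge[of z] x(2)[of z] arcs_out[of z] by (cases "z \<in> set vs") (auto simp: defect_def)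
  have d: "defect ?E \<rho> x z = 0" if z: "z \<in> set vs" for z
  proof (rule ccontr)
    assume "defect ?E \<rho> x z \<noteq> 0"
    then have "0 < defect ?E \<rho> x z" using d0[of z] by simp
    then obtain k where k: "\<forall>v\<in>set vs. 0 < (lazy_step ?E ^^ k) (defect ?E \<rho> x) v"
      using ex_funpow_lazy_step_pos[of ?E "defect ?E \<rho> x" z "set vs"] E d0 conn z by blast
    \<comment> \<open>Lazy steps commute with the defect, so slack at the single vertex
      \<open>z\<close> becomes slack at every vertex for \<open>y\<close>.\<close>
    define y where "y = (lazy_step ?E ^^ k) x"
    have pos: "\<forall>v\<in>set vs. 0 < defect ?E \<rho> y v"
      using k unfolding y_def defect_funpow_lazy_step .
    have y0: "0 \<le> y v" for v unfolding y_def by (rule funpow_lazy_step_nonneg[of x, OF x(1)])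
    have yu: "0 < y u"
      using x(4) funpow_lazy_step_mono[of x 0 k ?E u] x(1) unfolding y_def by simp
    define Y where "Y = Max (y ` set vs)"
    have Y: "y v \<le> Y" if "v \<in> set vs" for v using that by (simp add: Y_def)
    have Y0: "0 < Y" using Y[OF x(3)] yu by simp
    define d where "d = Min (defect ?E \<rho> y ` set vs)"
    have dle: "d \<le> defect ?E \<rho> y v" if "v \<in> set vs" for v using that by (simp add: d_def)
    have dpos: "0 < d" using pos x(3) unfolding d_def by (subst Min_gr_iff) auto
    \<comment> \<open>The least slack \<open>d\<close>, divided by the largest value
      \<open>Y\<close>, is an amount by which the factor can be raised at all vertices at
      once.\<close>
    have "(\<rho> + d / Y) * y v \<le> (\<Sum>w\<in>?E `` {v}. y w)" if v: "v \<in> set vs" for v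
    proof -
      have "d / Y * y v \<le> d / Y * Y" using Y[OF v] Y0 dpos by (intro mult_left_mono) auto
      also have "\<dots> = d" using Y0 by simp
      also have "\<dots> \<le> defect ?E \<rho> y v" using dle v .
      finally show ?thesis by (simp add: defect_def algebra_simps)
    qed
    then have "\<rho> + d / Y \<le> \<rho>"
      using spectral_radius_adjacency_mat_ge[OF vs, of y u] y0 x(3) yu unfolding rho by blast
    moreover have "0 < d / Y" using dpos Y0 by simp
    ultimately show False by simp
  qed
  \<comment> \<open>Outside \<open>vs\<close> both sides vanish; having the equation everywhere
    allows the equality of functions in \<open>step\<close>.\<close>
  then have eq: "(\<Sum>w\<in>?E `` {z}. x w) = \<rho> * x z" for z
    using x(2)[of z] arcs_out[of z] by (cases "z \<in> set vs") (auto simp: defect_def)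
  then show "v \<in> set vs \<Longrightarrow> (\<Sum>w\<in>?E `` {v}. x w) = \<rho> * x v" by simp
  show "0 < x v" if v: "v \<in> set vs"
  proof -
    obtain k where k: "\<forall>v\<in>set vs. 0 < (lazy_step ?E ^^ k) x v"
      using ex_funpow_lazy_step_pos[of ?E x u "set vs"] E x conn by blast
    \<comment> \<open>Now \<open>x\<close> is an eigenfunction of \<open>I + A\<close>, so lazy
      steps only rescale it; since they also make it positive on \<open>vs\<close>, it cannot vanish
      there. The factor \<open>c\<close> is what the induction on \<open>k\<close> consumes.\<close>
    have step: "lazy_step ?E (\<lambda>z. c * x z) = (\<lambda>z. (1 + \<rho>) * c * x z)" for c
      unfolding lazy_step_def sum_distrib_left[symmetric] eq by (simp add: algebra_simps)
    have "(lazy_step ?E ^^ k) x = (\<lambda>z. (1 + \<rho>) ^ k * x z)"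
      by (induction k) (simp_all add: step)
    then have "0 < (1 + \<rho>) ^ k * x v" using k v by simp
    then show ?thesis using x(1)[of v] by (metis less_eq_real_def mult_zero_right less_irrefl)
  qed
qed

section \<open>Walk gains, balance and potentials\<close>

lemma walk_gain_Nil [simp]: "walk_gain \<phi> [] = 1"
  and walk_gain_Cons [simp]: "walk_gain \<phi> (e # p) = \<phi> e * walk_gain \<phi> p"
  and walk_gain_append [simp]: "walk_gain \<phi> (p @ q) = walk_gain \<phi> p * walk_gain \<phi> q"
  by (simp_all add: walk_gain_def)

context T_gain_digraph
begin

lemma walk_gain_nonzero:
  assumes "set p \<subseteq> parcs D"
  shows "walk_gain \<phi> p \<noteq> 0"
  using assms gain_unit by (induction p) force+

text \<open>A nonempty closed walk that is not a cycle contains a shorter closed walk whose removal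
  leaves another shorter closed walk; gains and powers of \<open>\<mu>\<close> both multiply over
  the two pieces.\<close>

lemma walk_gain_closed:
  assumes bal: "mu_balanced D \<phi> \<mu>" and "awalk u p u"
  shows "walk_gain \<phi> p = \<mu> ^ length p"
  using assms(2)
proof (induction "length p" arbitrary: u p rule: less_induct)
  case less
  show ?case
  proof (cases p)
    case (Cons e es)
    show ?thesis
    proof (cases "distinct (tl (pawalk_verts u p))")
      case True
      then have "cycle p" using less.prems Cons unfolding cycle_def by auto
      then show ?thesis using bal unfolding mu_balanced_def by blast
    next
      case False
      have e: "e \<in> parcs D" "fst e = u" "awalk (snd e) es u"
        using less.prems Cons by (auto simp: awalk_Cons_iff)
      \<comment> \<open>The repetition is sought after the first arc: the full vertex list of
        \<open>p\<close> always repeats \<open>u\<close>, and cutting there could remove all of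
        \<open>p\<close>.\<close>
      have "\<not> distinct (pawalk_verts (snd e) es)" using False Cons by simp
      then obtain q r s w where decomp: "es = q @ r @ s" "0 < length r"
        "awalk (snd e) q w" "awalk w r w" "awalk w s u"
        using awalk_not_distinct_decomp[OF e(3)] by blast
      have "awalk u (e # q @ s) u"
        using decomp awalk_appendI[OF decomp(3,5)] e by (auto simp: awalk_Cons_iff)
      then have "walk_gain \<phi> (e # q @ s) = \<mu> ^ length (e # q @ s)"
        by (intro less.hyps) (use decomp Cons in auto)
      moreover have "walk_gain \<phi> r = \<mu> ^ length r"
        by (rule less.hyps[OF _ decomp(4)]) (use decomp Cons in auto)
      ultimately show ?thesis using Cons decomp(1) by (simp add: power_add mult_ac)
    qed
  qed simp
qed

text \<open>Balance on closed walks makes the normalised gain of a walk from a root depend only on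
  its endpoint. The resulting \<open>d\<close> is reciprocal to the one in
  \<open>mu_balancedI\<close>.\<close>

lemma ex_potential:
  assumes sc: "strongly_connected (with_proj D)" and bal: "mu_balanced D \<phi> \<mu>" and mu: "\<mu> \<noteq> 0"
  obtains d where "\<And>v. v \<in> pverts D \<Longrightarrow> d v \<noteq> 0"
    "\<And>v w. (v, w) \<in> parcs D \<Longrightarrow> d v * \<phi> (v, w) = \<mu> * d w"
proof -
  have ex: "\<exists>p. awalk u p v" if "u \<in> pverts D" "v \<in> pverts D" for u v
    using sc that unfolding strongly_connected_def reachable_awalk[symmetric] by simp
  obtain r where r: "r \<in> pverts D" using sc unfolding strongly_connected_def by auto
  obtain p where p: "\<And>v. v \<in> pverts D \<Longrightarrow> awalk r (p v) v" using ex[OF r] by metis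
  define d where "d v = walk_gain \<phi> (p v) / \<mu> ^ length (p v)" for v
  show thesis
  proof (rule that[of d])
    show "d v \<noteq> 0" if "v \<in> pverts D" for v
      using p[OF that] mu walk_gain_nonzero unfolding d_def by auto
    show "d v * \<phi> (v, w) = \<mu> * d w" if e: "(v, w) \<in> parcs D" for v w
    proof -
      have v: "v \<in> pverts D" and w: "w \<in> pverts D" using wellformed' e by auto
      obtain q where q: "awalk w q r" using ex[OF w r] by blast
      have q0: "walk_gain \<phi> q \<noteq> 0" using q by (intro walk_gain_nonzero) auto
      \<comment> \<open>One return walk \<open>q\<close> closes both the walk to \<open>v\<close>
        prolonged by the arc and the walk to \<open>w\<close>; comparing the two closed walks
        cancels the gain of \<open>q\<close>.\<close>
      have "awalk v ((v, w) # q) r" using e q by (simp add: awalk_Cons_iff)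
      from walk_gain_closed[OF bal awalk_appendI[OF p[OF v] this]]
      have 1: "walk_gain \<phi> (p v) * (\<phi> (v, w) * walk_gain \<phi> q) =
          \<mu> ^ length (p v) * (\<mu> * \<mu> ^ length q)"
        by (simp add: power_add)
      from walk_gain_closed[OF bal awalk_appendI[OF p[OF w] q]]
      have 2: "walk_gain \<phi> (p w) * walk_gain \<phi> q = \<mu> ^ length (p w) * \<mu> ^ length q"
        by (simp add: power_add)
      have "d v * \<phi> (v, w) * walk_gain \<phi> q = \<mu> * \<mu> ^ length q"
        using 1 mu by (simp add: d_def field_simps)
      moreover have "\<mu> * d w * walk_gain \<phi> q = \<mu> * \<mu> ^ length q"
        using 2 mu by (simp add: d_def field_simps)
      ultimately show ?thesis using q0 by (metis mult_right_cancel)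
    qed
  qed
qed

text \<open>The arc relation telescopes along any walk from \<open>u\<close> to \<open>v\<close>; on
  a closed walk the two values of \<open>d\<close> coincide and cancel.\<close>

lemma mu_balancedI:
  assumes nz: "\<And>v. v \<in> pverts D \<Longrightarrow> d v \<noteq> 0"
    and d: "\<And>v w. (v, w) \<in> parcs D \<Longrightarrow> \<phi> (v, w) * d w = \<mu> * d v"
  shows "mu_balanced D \<phi> \<mu>"
  unfolding mu_balanced_def
proof (intro allI impI)
  fix p assume "cycle p"
  then obtain u where u: "awalk u p u" unfolding cycle_def by blast
  have "walk_gain \<phi> p * d v = \<mu> ^ length p * d u" if "awalk u p v" for u v
    using that
  proof (induction p arbitrary: u)
    case (Cons e p)
    then have e: "e \<in> parcs D" "fst e = u" "awalk (snd e) p v" by (auto simp: awalk_Cons_iff)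
    have "walk_gain \<phi> (e # p) * d v = \<phi> e * (\<mu> ^ length p * d (snd e))"
      using Cons.IH[OF e(3)] by simp
    also have "\<dots> = \<mu> ^ length p * (\<phi> e * d (snd e))" by simp
    also have "\<phi> e * d (snd e) = \<mu> * d u" using d[of u "snd e"] e by (metis prod.collapse)
    finally show ?case by (simp add: mult_ac)
  qed (auto simp: awalk_Nil_iff)
  from this[OF u] show "walk_gain \<phi> p = \<mu> ^ length p" using nz u by auto
qed

end

section \<open>Tight triangle inequalities and the comparison of spectral radii\<close>

text \<open>Taking real parts, the nonnegative differences between modulus and real part sum to 0,
  so each of them vanishes.\<close>

lemma eq_of_real_norm_if_sum_eq:
  fixes a :: "'b \<Rightarrow> complex"
  assumes "finite S" and sum: "(\<Sum>w\<in>S. a w) = of_real (\<Sum>w\<in>S. cmod (a w))" and "w \<in> S"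
  shows "a w = of_real (cmod (a w))"
proof -
  have "(\<Sum>w\<in>S. cmod (a w) - Re (a w)) = 0"
    using arg_cong[OF sum, of Re] by (simp add: sum_subtractf)
  then have "cmod (a w) - Re (a w) = 0"
    using assms(1,3) by (subst (asm) sum_nonneg_eq_0_iff) (auto simp: complex_Re_le_cmod)
  then have Re: "cmod (a w) = Re (a w)" by simp
  then have "Im (a w) = 0" using cmod_power2[of "a w"] by simp
  with Re show ?thesis by (simp add: complex_eq_iff)
qed

theorem theorem3p7:
  fixes D :: "'a pair_pre_digraph"
    and \<phi> :: "'a \<times> 'a \<Rightarrow> complex"
    and vs :: "'a list"
  assumes "T_gain_digraph D \<phi>"
    and "strongly_connected (with_proj D)"
    and "distinct vs" and "set vs = pverts D"
  shows "spectral_radius (gain_adjacency_mat D \<phi> vs) \<le> spectral_radius (adjacency_mat D vs) \<and>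
    (spectral_radius (gain_adjacency_mat D \<phi> vs) = spectral_radius (adjacency_mat D vs) \<longleftrightarrow>
      (\<exists>\<mu>. cmod \<mu> = 1 \<and> mu_balanced D \<phi> \<mu>))"
proof -
  interpret T_gain_digraph D \<phi> by fact
  let ?A = "adjacency_mat D vs" and ?B = "gain_adjacency_mat D \<phi> vs" and ?E = "parcs D"
  define \<rho> where "\<rho> = spectral_radius ?A"
  have E: "?E \<subseteq> set vs \<times> set vs" using wellformed' assms(4) by auto
  note vs = assms(3) E
  have conn: "(u, v) \<in> ?E\<^sup>*" if "u \<in> set vs" "v \<in> set vs" for u v
    using assms(2,4) that reachable_rtranclI[of "with_proj D" u v]
    unfolding strongly_connected_def by simp
  have n: "0 < length vs" using assms(2,4) unfolding strongly_connected_def by auto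
  have fin: "finite (?E `` {v})" for v using pair_finite_arcs by (simp add: finite_Image)
  have B: "?B \<in> carrier_mat (length vs) (length vs)" by (rule gain_adjacency_mat_carrier)
  have A: "?A \<in> carrier_mat (length vs) (length vs)"
    unfolding adjacency_mat_eq_gain_adjacency_mat by (rule gain_adjacency_mat_carrier)
  have norm_arc: "cmod (\<phi> (v, w) * z) = cmod z" if "w \<in> ?E `` {v}" for v w z
    using that gain_unit by (simp add: norm_mult)
  obtain l where l: "eigenvalue ?B l" "cmod l = spectral_radius ?B"
    using ex_eigenvalue_spectral_radius[OF B n] .
  obtain f u where u: "u \<in> set vs" "f u \<noteq> 0" and f0: "\<And>v. v \<notin> set vs \<Longrightarrow> f v = 0"
    and f: "\<And>v. (\<Sum>w\<in>?E `` {v}. \<phi> (v, w) * f w) = l * f v"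
    using eigenvalue_gain_adjacency_matE[OF vs l(1)] by metis
  have sub: "cmod l * cmod (f v) \<le> (\<Sum>w\<in>?E `` {v}. cmod (f w))" for v
  proof -
    have "cmod l * cmod (f v) = cmod (\<Sum>w\<in>?E `` {v}. \<phi> (v, w) * f w)" by (simp add: f norm_mult)
    also have "\<dots> \<le> (\<Sum>w\<in>?E `` {v}. cmod (\<phi> (v, w) * f w))" by (rule norm_sum)
    also have "\<dots> = (\<Sum>w\<in>?E `` {v}. cmod (f w))" by (intro sum.cong refl norm_arc)
    finally show ?thesis .
  qed
  have le: "spectral_radius ?B \<le> \<rho>"
    unfolding \<rho>_def l(2)[symmetric]
    by (rule spectral_radius_adjacency_mat_ge[OF vs, of "\<lambda>v. cmod (f v)" u]) (use u sub in auto)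
  have "\<exists>\<mu>. cmod \<mu> = 1 \<and> mu_balanced D \<phi> \<mu>" if eq: "spectral_radius ?B = \<rho>"
  proof -
    have l_rho: "cmod l = \<rho>" using l eq by simp
    note inv = subinvariant_at_spectral_radius[OF vs conn, of "\<lambda>v. cmod (f v)" u \<rho>]
    have f_eq: "(\<Sum>w\<in>?E `` {v}. cmod (f w)) = \<rho> * cmod (f v)" if "v \<in> set vs" for v
      by (rule inv(1)) (use u f0 \<rho>_def sub l_rho that in auto)
    have f_pos: "f v \<noteq> 0" if "v \<in> set vs" for v
      using inv(2)[of v] u f0 \<rho>_def sub l_rho that by auto
    \<comment> \<open>The phase of \<open>l\<close>; if \<open>\<rho>\<close> is 0 then so is
      \<open>l\<close>, and the default 1 is a valid phase.\<close>
    define \<mu> where "\<mu> = (if \<rho> = 0 then 1 else l / of_real \<rho>)"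
    have mu: "cmod \<mu> = 1" "l = of_real \<rho> * \<mu>"
      using l_rho by (auto simp: \<mu>_def norm_divide)
    define d where "d v = sgn (f v)" for v
    have d: "cmod (d v) = 1" if "v \<in> set vs" for v using f_pos[OF that] by (simp add: d_def norm_sgn)
    have fd: "f v = of_real (cmod (f v)) * d v" for v
      by (simp add: d_def sgn_eq)
    have "\<phi> (v, w) * d w = \<mu> * d v" if e: "(v, w) \<in> ?E" for v w
    proof -
      have v: "v \<in> set vs" and w: "w \<in> set vs" using e E by auto
      \<comment> \<open>Rotating by \<open>cnj c\<close> turns the row sum at \<open>v\<close> into
        the real number \<open>\<rho> * cmod (f v)\<close>, which is also the sum of the moduli, so
        every rotated term is real and nonnegative.\<close>
      define c where "c = \<mu> * d v"
      have c: "cmod c = 1" using mu d[OF v] by (simp add: c_def norm_mult)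
      have cc: "cnj c * c = 1" using c complex_norm_square[of c] by (simp add: mult.commute)
      define a where "a z = cnj c * (\<phi> (v, z) * f z)" for z
      have norm_a: "cmod (a z) = cmod (f z)" if "z \<in> ?E `` {v}" for z
        using norm_arc[OF that] c by (simp add: a_def norm_mult)
      have sum_a: "(\<Sum>z\<in>?E `` {v}. cmod (a z)) = \<rho> * cmod (f v)"
        unfolding f_eq[OF v, symmetric] by (rule sum.cong[OF refl norm_a])
      have "(\<Sum>z\<in>?E `` {v}. a z) = cnj c * (l * f v)"
        unfolding a_def by (simp only: f[symmetric] sum_distrib_left)
      also have "\<dots> = cnj c * c * of_real (\<rho> * cmod (f v))"
        by (subst fd) (simp add: c_def mu(2) mult_ac)
      also have "\<dots> = of_real (\<Sum>z\<in>?E `` {v}. cmod (a z))"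
        unfolding sum_a cc by simp
      finally have "a w = of_real (cmod (a w))"
        by (rule eq_of_real_norm_if_sum_eq[OF fin]) (use e in simp)
      then have "cnj c * (\<phi> (v, w) * f w) = of_real (cmod (f w))"
        using norm_a[of w] e unfolding a_def by simp
      then have "c * (cnj c * (\<phi> (v, w) * f w)) = c * of_real (cmod (f w))" by simp
      then have "\<phi> (v, w) * f w = c * of_real (cmod (f w))"
        using cc by (simp add: mult.assoc[symmetric] mult.commute[of c])
      then have "\<phi> (v, w) * d w * of_real (cmod (f w)) = c * of_real (cmod (f w))"
        by (subst (asm) fd) (simp add: mult_ac)
      then show ?thesis using f_pos[OF w] unfolding c_def by simp
    qed
    moreover have "d v \<noteq> 0" if "v \<in> pverts D" for v using d[of v] that assms(4) by auto
    ultimately have "mu_balanced D \<phi> \<mu>" by (intro mu_balancedI[of d])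
    then show ?thesis using mu by blast
  qed
  moreover have "spectral_radius ?B = \<rho>" if mu: "cmod \<mu> = 1" and bal: "mu_balanced D \<phi> \<mu>" for \<mu>
  proof (rule antisym[OF le])
    have "\<mu> \<noteq> 0" using mu by auto
    then obtain d where d0: "\<And>v. v \<in> pverts D \<Longrightarrow> d v \<noteq> 0"
      and d: "\<And>v w. (v, w) \<in> ?E \<Longrightarrow> d v * \<phi> (v, w) = \<mu> * d w"
      using ex_potential[OF assms(2) bal] by metis
    \<comment> \<open>Only the modulus of \<open>k\<close> matters: multiplication by the unit
      \<open>\<mu>\<close> preserves it.\<close>
    obtain k where k: "eigenvalue ?A k" "cmod k = \<rho>"
      using ex_eigenvalue_spectral_radius[OF A n] unfolding \<rho>_def .
    obtain g r where r: "r \<in> set vs" "g r \<noteq> 0"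
      and g: "\<And>v. (\<Sum>w\<in>?E `` {v}. 1 * g w) = k * g v"
      using eigenvalue_gain_adjacency_matE[OF vs, of "\<lambda>_. 1"] k(1)
      unfolding adjacency_mat_eq_gain_adjacency_mat by metis
    have "eigenvalue ?B (\<mu> * k)"
    proof (rule eigenvalue_gain_adjacency_matI[OF vs r(1), of "\<lambda>v. g v / d v"])
      show "g r / d r \<noteq> 0" using r d0 assms(4) by auto
      fix v assume v: "v \<in> set vs"
      \<comment> \<open>Dividing by the potential replaces each gain by \<open>\<mu>\<close>: this
        is the diagonal similarity, applied to the eigenfunction \<open>g\<close>.\<close>
      have "\<phi> (v, w) * (g w / d w) = \<mu> / d v * (1 * g w)" if "w \<in> ?E `` {v}" for w
        using d[of v w] d0[of v] d0[of w] that v assms(4) E by (auto simp: field_simps)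
      then have "(\<Sum>w\<in>?E `` {v}. \<phi> (v, w) * (g w / d w)) = \<mu> / d v * (\<Sum>w\<in>?E `` {v}. 1 * g w)"
        unfolding sum_distrib_left by (rule sum.cong[OF refl])
      then show "(\<Sum>w\<in>?E `` {v}. \<phi> (v, w) * (g w / d w)) = \<mu> * k * (g v / d v)"
        unfolding g by simp
    qed
    from norm_eigenvalue_le_spectral_radius[OF B this]
    show "\<rho> \<le> spectral_radius ?B" using mu k by (simp add: norm_mult)
  qed
  ultimately show ?thesis using le unfolding \<rho>_def by blast
qed

end
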